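(* Let $X$ be a Banach space and let $\alpha$ be a cross-norm on $X\odot X$ such that $B_{X^*}\otimes_{\alpha^*}B_{X^*}=B_{(X\otimes_\alpha X)^*}$. Let $\{x_k\}_{k\ge1}$ be a bounded sequence in $X$. Then the following assertions are equivalent: (i) the sequence $\{x_k\otimes x_k\}$ is ergodic in $X\otimes_\alpha X$; (ii) the sequence $\{x_k\otimes x_k\}$ is uniformly weakly mixing to zero in $X\otimes_\alpha X$; (iii) $\{x_k\}$ is uniformly weakly mixing to zero.
   Context: For a Banach space $Z$, $Z^*$ is its dual and $B_Z=\{z\in Z:\|z\|\le 1\}$. $X\odot X$ is the algebraic tensor product; $X\otimes_\alpha X$ is its completion with respect to the cross-norm $\alpha$ (i.e. $\alpha(x\otimes y)=\|x\|\|y\|$). $\alpha^*$ is the conjugate (dual) norm on $X^*\odot X^*$, $\alpha^*(\varphi)=\sup\{|\varphi(u)|:u\in X\odot X,\ \alpha(u)\le1\}$, where $(f\otimes g)(x\otimes y)=f(x)g(y)$; it is part of the setting that $\alpha^*$ is (finite and) a cross-norm. Thus $X^*\odot X^*$ with $\alpha^*$ sits isometrically in $(X\otimes_\alpha X)^*$. $B_{X^*}\odot B_{X^*}=\{\sum_{k=1}^n\lambda_k f_k\otimes g_k:\ n\in\mathbb N,\ f_k, g_k\in B_{X^*},\ \lambda_k\ge0,\ \sum_{k=1}^n\lambda_k\le1\}$, and $B_{X^*}\otimes_{\alpha^*}B_{X^*}$ is its closure with respect to $\alpha^*$ (regarded as a subset of $(X\otimes_\alpha X)^*$). A sequence $\{z_k\}_{k\ge1}$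 in a Banach space $Z$ is ergodic if $\lim_{n\to\infty}\frac1n\|\sum_{k=1}^n z_k\|=0$; it is uniformly weakly mixing to zero if $\lim_{n\to\infty}\sup\{\frac1n\sum_{k=1}^n|f(z_k)|: f\in B_{Z^*}\}=0$.
   Formalization: The Banach space X is taken over the real scalars; over the complex scalars (i) does not imply (iii), e.g. X = C with x_k = exp(ikt), exp(2it) ≠ 1. *)

theory Defs
  imports "HOL-Analysis.Analysis"
begin

section \<open>The algebraic tensor product\<close>

text \<open>
  An elementary tensor of x and y is the functional B \<mapsto> B x y on the space of bilinear forms,
  and the algebraic tensor product is the linear span of these functionals. Elements of the span
  are finite sums of elementary tensors, since scalars can be moved into the first factor.
  Functions that are not bilinear forms are sent to 0, so that equality of tensors
  is equality on bilinear forms.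
\<close>

typedef (overloaded) ('a::real_vector, 'b::real_vector) tensor =
  "{\<phi> :: ('a \<Rightarrow> 'b \<Rightarrow> real) \<Rightarrow> real.
      \<exists>xs. \<phi> = (\<lambda>B. if bilinear B then (\<Sum>(x, y)\<leftarrow>xs. B x y) else 0)}"
  morphisms eval_tensor Abs_tensor
  by blast

setup_lifting type_definition_tensor

lift_definition tensor :: "'a::real_vector \<Rightarrow> 'b::real_vector \<Rightarrow> ('a, 'b) tensor"
    (infixr "\<otimes>\<^sub>t" 75)
  is "\<lambda>x y B. if bilinear B then B x y else 0"
proof -
  fix x :: 'a and y :: 'b
  show "\<exists>xs. (\<lambda>B. if bilinear B then B x y else 0) =
      (\<lambda>B :: 'a \<Rightarrow> 'b \<Rightarrow> real. if bilinear B then (\<Sum>(x, y)\<leftarrow>xs. B x y) else 0)"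
    by (rule exI[of _ "[(x, y)]"], rule ext) simp
qed

instantiation tensor :: (real_vector, real_vector) real_vector
begin

lift_definition zero_tensor :: "('a, 'b) tensor" is "\<lambda>_. 0"
  by (rule exI[of _ "[]"]) auto

lift_definition plus_tensor :: "('a, 'b) tensor \<Rightarrow> ('a, 'b) tensor \<Rightarrow> ('a, 'b) tensor"
  is "\<lambda>\<phi> \<psi> B. \<phi> B + \<psi> B"
proof -
  fix \<phi> \<psi> :: "('a \<Rightarrow> 'b \<Rightarrow> real) \<Rightarrow> real"
  assume "\<exists>xs. \<phi> = (\<lambda>B. if bilinear B then (\<Sum>(x, y)\<leftarrow>xs. B x y) else 0)"
    and "\<exists>xs. \<psi> = (\<lambda>B. if bilinear B then (\<Sum>(x, y)\<leftarrow>xs. B x y) else 0)"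
  then obtain xs ys where
    "\<phi> = (\<lambda>B. if bilinear B then (\<Sum>(x, y)\<leftarrow>xs. B x y) else 0)"
    "\<psi> = (\<lambda>B. if bilinear B then (\<Sum>(x, y)\<leftarrow>ys. B x y) else 0)" by blast
  then have "(\<lambda>B. \<phi> B + \<psi> B) = (\<lambda>B. if bilinear B then (\<Sum>(x, y)\<leftarrow>xs @ ys. B x y) else 0)"
    by auto
  then show "\<exists>xs. (\<lambda>B. \<phi> B + \<psi> B) = (\<lambda>B. if bilinear B then (\<Sum>(x, y)\<leftarrow>xs. B x y) else 0)" ..
qed

lift_definition scaleR_tensor :: "real \<Rightarrow> ('a, 'b) tensor \<Rightarrow> ('a, 'b) tensor"
  is "\<lambda>c \<phi> B. c * \<phi> B"
proof -
  fix c :: real and \<phi> :: "('a \<Rightarrow> 'b \<Rightarrow> real) \<Rightarrow> real"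
  assume "\<exists>xs. \<phi> = (\<lambda>B. if bilinear B then (\<Sum>(x, y)\<leftarrow>xs. B x y) else 0)"
  then obtain xs where
    1: "\<phi> = (\<lambda>B. if bilinear B then (\<Sum>(x, y)\<leftarrow>xs. B x y) else 0)" by blast
  have "c * (\<Sum>(x, y)\<leftarrow>xs. B x y) = (\<Sum>(x, y)\<leftarrow>map (\<lambda>(x, y). (c *\<^sub>R x, y)) xs. B x y)"
    if "bilinear B" for B :: "'a \<Rightarrow> 'b \<Rightarrow> real"
    by (induction xs) (auto simp: algebra_simps bilinear_lmul[OF that])
  then have "(\<lambda>B. c * \<phi> B) = (\<lambda>B. if bilinear B
      then (\<Sum>(x, y)\<leftarrow>map (\<lambda>(x, y). (c *\<^sub>R x, y)) xs. B x y) else 0)"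
    unfolding 1 by (intro ext) auto
  then show "\<exists>xs. (\<lambda>B. c * \<phi> B) = (\<lambda>B. if bilinear B then (\<Sum>(x, y)\<leftarrow>xs. B x y) else 0)" ..
qed

definition uminus_tensor :: "('a, 'b) tensor \<Rightarrow> ('a, 'b) tensor"
  where "uminus_tensor u = (- 1) *\<^sub>R u"

definition minus_tensor :: "('a, 'b) tensor \<Rightarrow> ('a, 'b) tensor \<Rightarrow> ('a, 'b) tensor"
  where "minus_tensor u v = u + (- v)"

instance
  by standard
    (unfold minus_tensor_def uminus_tensor_def, (transfer, auto simp: algebra_simps)+)

end

lemma eval_tensor_elementary: "bilinear B \<Longrightarrow> eval_tensor (x \<otimes>\<^sub>t y) B = B x y"
  by transfer simp

lemma linear_eval_tensor: "linear (\<lambda>u. eval_tensor u B)"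
  by (rule linearI) (simp_all add: plus_tensor.rep_eq scaleR_tensor.rep_eq)

lemma eval_tensor_sum_list:
  "bilinear B \<Longrightarrow> eval_tensor (\<Sum>(x, y)\<leftarrow>xs. x \<otimes>\<^sub>t y) B = (\<Sum>(x, y)\<leftarrow>xs. B x y)"
  by (induction xs)
     (auto simp: zero_tensor.rep_eq plus_tensor.rep_eq eval_tensor_elementary)

lemma eval_tensor_not_bilinear: "\<not> bilinear B \<Longrightarrow> eval_tensor u B = 0"
  by transfer auto

lemma tensor_eqI:
  assumes "\<And>B. bilinear B \<Longrightarrow> eval_tensor u B = eval_tensor v B"
  shows "u = v"
proof -
  have "eval_tensor u = eval_tensor v"
  proof
    fix B
    show "eval_tensor u B = eval_tensor v B"
      by (cases "bilinear B") (simp_all add: assms eval_tensor_not_bilinear)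
  qed
  then show ?thesis by (simp add: eval_tensor_inject)
qed

lemma tensor_cases:
  obtains xs where "u = (\<Sum>(x, y)\<leftarrow>xs. x \<otimes>\<^sub>t y)"
proof -
  obtain xs where "eval_tensor u = (\<lambda>B. if bilinear B then (\<Sum>(x, y)\<leftarrow>xs. B x y) else 0)"
    using eval_tensor[of u] by blast
  then have "u = (\<Sum>(x, y)\<leftarrow>xs. x \<otimes>\<^sub>t y)"
    by (intro tensor_eqI) (simp add: eval_tensor_sum_list)
  then show ?thesis by (rule that)
qed

lemma bilinear_tensor: "bilinear (\<otimes>\<^sub>t)"
  unfolding bilinear_def
  by (intro conjI allI linearI tensor_eqI)
     (simp_all add: eval_tensor_elementary plus_tensor.rep_eq scaleR_tensor.rep_eq
        bilinear_ladd bilinear_radd bilinear_lmul bilinear_rmul)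

text \<open>The universal property of the tensor product.\<close>

lemma tensor_universal:
  fixes h :: "'a::real_vector \<Rightarrow> 'b::real_vector \<Rightarrow> 'c::real_vector"
  assumes h: "bilinear h"
  shows "\<exists>!L. linear L \<and> (\<forall>x y. L (x \<otimes>\<^sub>t y) = h x y)"
proof -
  let ?S = "\<lambda>xs. \<Sum>(x, y)\<leftarrow>xs. x \<otimes>\<^sub>t y"
  let ?H = "\<lambda>xs. \<Sum>(x, y)\<leftarrow>xs. h x y"
  have wd: "?H xs = ?H ys" if eq: "?S xs = ?S ys" for xs ys
  proof (rule ccontr)
    assume "?H xs \<noteq> ?H ys"
    then have nz: "?H xs - ?H ys \<noteq> 0" by simp
    then have ind: "independent {?H xs - ?H ys}"
      by simp
    obtain g :: "'c \<Rightarrow> real" where g: "linear g" "g (?H xs - ?H ys) = 1"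
      using linear_independent_extend[OF ind, of "\<lambda>_. 1::real"] by auto
    have bil: "bilinear (\<lambda>x y. g (h x y))"
      using h g(1) unfolding bilinear_def
      by (auto intro: linear_compose[unfolded o_def])
    have gs: "g (?H zs) = (\<Sum>(x, y)\<leftarrow>zs. g (h x y))" for zs
      by (induction zs) (auto simp: linear_0[OF g(1)] linear_add[OF g(1)])
    have "g (?H xs) = g (?H ys)"
      using eval_tensor_sum_list[OF bil, of xs] eval_tensor_sum_list[OF bil, of ys] eq
      by (simp add: gs)
    with g show False by (simp add: linear_diff[OF g(1)])
  qed
  define L where "L = (\<lambda>u. ?H (SOME xs. u = ?S xs))"
  have LS: "L (?S xs) = ?H xs" for xs
    unfolding L_def by (rule wd, rule someI2[of _ xs]) auto
  have lin: "linear L"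
  proof (rule linearI)
    fix u v :: "('a, 'b) tensor"
    obtain xs where u: "u = ?S xs" by (rule tensor_cases)
    obtain ys where v: "v = ?S ys" by (rule tensor_cases)
    have "u + v = ?S (xs @ ys)" by (simp add: u v)
    then show "L (u + v) = L u + L v" by (simp only: LS u v) simp
  next
    fix c and u :: "('a, 'b) tensor"
    obtain xs where u: "u = ?S xs" by (rule tensor_cases)
    have 1: "c *\<^sub>R ?S xs = ?S (map (\<lambda>(x, y). (c *\<^sub>R x, y)) xs)"
      by (induction xs) (auto simp: scaleR_add_right bilinear_lmul[OF bilinear_tensor])
    have 2: "c *\<^sub>R ?H xs = ?H (map (\<lambda>(x, y). (c *\<^sub>R x, y)) xs)"
      by (induction xs) (auto simp: scaleR_add_right bilinear_lmul[OF h])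
    show "L (c *\<^sub>R u) = c *\<^sub>R L u" by (simp only: u 1 2 LS)
  qed
  have Lh: "L (x \<otimes>\<^sub>t y) = h x y" for x y
    using LS[of "[(x, y)]"] by simp
  have "M = L" if M: "linear M" "\<forall>x y. M (x \<otimes>\<^sub>t y) = h x y" for M
  proof
    fix u :: "('a, 'b) tensor"
    obtain xs where u: "u = ?S xs" by (rule tensor_cases)
    have "M (?S xs) = ?H xs"
      by (induction xs) (auto simp: linear_0[OF M(1)] linear_add[OF M(1)] M(2))
    then show "M u = L u" by (simp add: u LS)
  qed
  with lin Lh show ?thesis by blast
qed


section \<open>Cross-norms, dual norms and completions\<close>

definition is_norm :: "('v::real_vector \<Rightarrow> real) \<Rightarrow> bool" where
  "is_norm \<alpha> \<longleftrightarrow>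
     (\<forall>u. 0 \<le> \<alpha> u) \<and> (\<forall>u. \<alpha> u = 0 \<longleftrightarrow> u = 0) \<and>
     (\<forall>u v. \<alpha> (u + v) \<le> \<alpha> u + \<alpha> v) \<and> (\<forall>c u. \<alpha> (c *\<^sub>R u) = \<bar>c\<bar> * \<alpha> u)"

definition cross_norm :: "(('a::real_normed_vector, 'b::real_normed_vector) tensor \<Rightarrow> real) \<Rightarrow> bool"
  where "cross_norm \<alpha> \<longleftrightarrow> is_norm \<alpha> \<and> (\<forall>x y. \<alpha> (x \<otimes>\<^sub>t y) = norm x * norm y)"

text \<open>
  The duality between the tensor product of the dual spaces and the tensor product of the spaces,
  characterised by \<open>tensor_pairing_elementary\<close> and bilinearity.
\<close>

definition tensor_pairing ::
  "('a::real_normed_vector \<Rightarrow>\<^sub>L real, 'b::real_normed_vector \<Rightarrow>\<^sub>L real) tensor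
    \<Rightarrow> ('a, 'b) tensor \<Rightarrow> real"
  where "tensor_pairing \<phi> u =
    eval_tensor u (\<lambda>x y. eval_tensor \<phi> (\<lambda>f g. blinfun_apply f x * blinfun_apply g y))"

lemma bilinear_pairing_left:
  "bilinear (\<lambda>(f :: 'a::real_normed_vector \<Rightarrow>\<^sub>L real) (g :: 'b::real_normed_vector \<Rightarrow>\<^sub>L real).
      blinfun_apply f x * blinfun_apply g y)"
  unfolding bilinear_def
  by (auto intro!: linearI simp: blinfun.add_left blinfun.scaleR_left algebra_simps)

lemma bilinear_pairing_right:
  "bilinear (\<lambda>(x :: 'a::real_normed_vector) (y :: 'b::real_normed_vector).
      eval_tensor \<phi> (\<lambda>f g. blinfun_apply f x * blinfun_apply g y))"
proof -
  obtain xs where \<phi>: "\<phi> = (\<Sum>(f, g)\<leftarrow>xs. f \<otimes>\<^sub>t g)" by (rule tensor_cases)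
  have "bilinear (\<lambda>(x :: 'a) (y :: 'b). \<Sum>(f, g)\<leftarrow>xs. blinfun_apply f x * blinfun_apply g y)"
    unfolding bilinear_def
    by (auto intro!: linearI simp: case_prod_unfold blinfun.add_right blinfun.scaleR_right
          algebra_simps sum_list_addf sum_list_const_mult)
  then show ?thesis by (simp add: \<phi> eval_tensor_sum_list bilinear_pairing_left)
qed

lemma tensor_pairing_elementary:
  "tensor_pairing (f \<otimes>\<^sub>t g) (x \<otimes>\<^sub>t y) = blinfun_apply f x * blinfun_apply g y"
  unfolding tensor_pairing_def
  by (subst eval_tensor_elementary, rule bilinear_pairing_right)
     (rule eval_tensor_elementary[OF bilinear_pairing_left])

lemma linear_tensor_pairing: "linear (tensor_pairing \<phi>)"
  unfolding tensor_pairing_def by (rule linear_eval_tensor)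

lemma bilinear_tensor_pairing: "bilinear tensor_pairing"
  unfolding bilinear_def
proof (intro conjI allI)
  fix \<phi> :: "('a \<Rightarrow>\<^sub>L real, 'b \<Rightarrow>\<^sub>L real) tensor"
  show "linear (tensor_pairing \<phi>)" by (rule linear_tensor_pairing)
next
  fix u :: "('a, 'b) tensor"
  obtain xs where u: "u = (\<Sum>(x, y)\<leftarrow>xs. x \<otimes>\<^sub>t y)" by (rule tensor_cases)
  have eq: "tensor_pairing \<phi> u =
      (\<Sum>(x, y)\<leftarrow>xs. eval_tensor \<phi> (\<lambda>f g. blinfun_apply f x * blinfun_apply g y))" for \<phi>
    unfolding tensor_pairing_def u by (rule eval_tensor_sum_list[OF bilinear_pairing_right])
  show "linear (\<lambda>\<phi>. tensor_pairing \<phi> u)"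
    unfolding eq
    by (auto intro!: linearI simp: case_prod_unfold plus_tensor.rep_eq scaleR_tensor.rep_eq
          sum_list_addf sum_list_const_mult)
qed

text \<open>
  The supremum is taken in the reals, so \<open>dual_norm \<alpha> \<phi>\<close> is meaningful only when
  \<open>dual_norm_finite\<close> holds.
\<close>

definition dual_norm ::
  "(('a::real_normed_vector, 'b::real_normed_vector) tensor \<Rightarrow> real)
    \<Rightarrow> ('a \<Rightarrow>\<^sub>L real, 'b \<Rightarrow>\<^sub>L real) tensor \<Rightarrow> real"
  where "dual_norm \<alpha> \<phi> = Sup {\<bar>tensor_pairing \<phi> u\<bar> | u. \<alpha> u \<le> 1}"

definition dual_norm_finite ::
  "(('a::real_normed_vector, 'b::real_normed_vector) tensor \<Rightarrow> real) \<Rightarrow> bool"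
  where "dual_norm_finite \<alpha> \<longleftrightarrow> (\<forall>\<phi>. bdd_above {\<bar>tensor_pairing \<phi> u\<bar> | u. \<alpha> u \<le> 1})"

text \<open>
  The completion of a vector space with respect to a norm \<open>\<alpha>\<close> is a Banach space into which the
  normed space embeds isometrically with dense range; it is determined up to isometric isomorphism.
  As the norm is a term and not a type-class instance, the completion is given by its embedding.
\<close>

definition is_completion :: "('v::real_vector \<Rightarrow> real) \<Rightarrow> ('v \<Rightarrow> 'z::banach) \<Rightarrow> bool"
  where "is_completion \<alpha> J \<longleftrightarrow>
    linear J \<and> (\<forall>u. norm (J u) = \<alpha> u) \<and> closure (range J) = UNIV"

text \<open>
  The embedding of the tensor product of the duals into the dual of the completion;
  well-defined and isometric by \<open>dual_embed\<close> and \<open>norm_dual_embed\<close> below.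
\<close>

definition dual_embed ::
  "(('a::real_normed_vector, 'b::real_normed_vector) tensor \<Rightarrow> 'z::banach)
    \<Rightarrow> ('a \<Rightarrow>\<^sub>L real, 'b \<Rightarrow>\<^sub>L real) tensor \<Rightarrow> ('z \<Rightarrow>\<^sub>L real)"
  where "dual_embed J \<phi> = (THE \<Psi>. \<forall>u. blinfun_apply \<Psi> (J u) = tensor_pairing \<phi> u)"

lemma tensor_pairing_bound:
  assumes \<alpha>: "is_norm \<alpha>" and fin: "dual_norm_finite \<alpha>"
  shows "\<bar>tensor_pairing \<phi> u\<bar> \<le> dual_norm \<alpha> \<phi> * \<alpha> u"
proof (cases "u = 0")
  case True
  moreover have "\<alpha> 0 = 0" using \<alpha> unfolding is_norm_def by blast
  ultimately show ?thesis
    using bilinear_rzero[OF bilinear_tensor_pairing, of \<phi>] by simp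
next
  case False
  then have pos: "\<alpha> u > 0" using \<alpha> by (metis is_norm_def less_eq_real_def)
  have "\<alpha> ((1 / \<alpha> u) *\<^sub>R u) = \<bar>1 / \<alpha> u\<bar> * \<alpha> u"
    using \<alpha> unfolding is_norm_def by blast
  then have "\<alpha> ((1 / \<alpha> u) *\<^sub>R u) \<le> 1"
    using pos by simp
  then have "\<bar>tensor_pairing \<phi> ((1 / \<alpha> u) *\<^sub>R u)\<bar> \<le> dual_norm \<alpha> \<phi>"
    unfolding dual_norm_def
    using fin by (intro cSup_upper) (auto simp: dual_norm_finite_def)
  then have "\<bar>tensor_pairing \<phi> u\<bar> / \<alpha> u \<le> dual_norm \<alpha> \<phi>"
    using pos by (simp add: bilinear_rmul[OF bilinear_tensor_pairing] abs_mult)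
  then show ?thesis using pos by (simp add: field_simps)
qed

lemma dual_extension_exists:
  fixes J :: "('a::real_normed_vector, 'b::real_normed_vector) tensor \<Rightarrow> 'z::banach"
  assumes \<alpha>: "is_norm \<alpha>" and fin: "dual_norm_finite \<alpha>" and J: "is_completion \<alpha> J"
  shows "\<exists>\<Psi>. (\<forall>u. blinfun_apply \<Psi> (J u) = tensor_pairing \<phi> u) \<and> norm \<Psi> \<le> dual_norm \<alpha> \<phi>"
proof -
  let ?p = "tensor_pairing \<phi>" and ?K = "dual_norm \<alpha> \<phi>"
  have lJ: "linear J" and nJ: "\<And>u. norm (J u) = \<alpha> u" and dJ: "closure (range J) = UNIV"
    using J by (auto simp: is_completion_def)
  have lp: "linear ?p" by (rule linear_tensor_pairing)
  have bd: "\<bar>?p u\<bar> \<le> ?K * norm (J u)" for u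
    unfolding nJ by (rule tensor_pairing_bound[OF \<alpha> fin])
  have K0: "0 \<le> ?K"
  proof -
    have "\<alpha> 0 = 0" using \<alpha> by (simp add: is_norm_def)
    then have "\<bar>?p 0\<bar> \<le> ?K"
      unfolding dual_norm_def
      using fin unfolding dual_norm_finite_def
      by (intro cSup_upper) (rule CollectI, rule exI[of _ 0], simp_all)
    then show ?thesis by linarith
  qed
  define f where "f = (\<lambda>z. ?p (inv J z))"
  have "inj J"
    using \<alpha> nJ unfolding linear_injective_0[OF lJ] is_norm_def by (metis norm_zero)
  then have fJ: "f (J u) = ?p u" for u by (simp add: f_def)
  have "K-lipschitz_on (range J) f" if "K = ?K" for K
  proof (rule lipschitz_onI)
    fix x y assume "x \<in> range J" "y \<in> range J"
    then obtain u v where "x = J u" "y = J v" by blast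
    then show "dist (f x) (f y) \<le> K * dist x y"
      using bd[of "u - v"] that
      by (simp add: fJ dist_norm linear_diff[OF lp] linear_diff[OF lJ])
  qed (use K0 that in simp)
  then have "uniformly_continuous_on (range J) f"
    using lipschitz_on_uniformly_continuous by blast
  then obtain g where g: "uniformly_continuous_on (closure (range J)) g"
      and gf: "\<And>x. x \<in> range J \<Longrightarrow> f x = g x"
    by (rule uniformly_continuous_on_extension_on_closure) (rule that)
  have cg: "continuous_on UNIV g"
    using uniformly_continuous_imp_continuous[OF g] by (simp add: dJ)
  have gJ: "g (J u) = ?p u" for u using gf[of "J u"] fJ by simp
  have approx: "\<exists>s. (\<lambda>n. J (s n)) \<longlonglongrightarrow> z" for z
  proof -
    have "z \<in> closure (range J)" by (simp add: dJ)
    then obtain t where t: "\<And>n. t n \<in> range J" "t \<longlonglongrightarrow> z"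
      unfolding closure_sequential by blast
    then have "J (inv J (t n)) = t n" for n by (simp add: f_inv_into_f)
    then show ?thesis using t(2) by (intro exI[of _ "\<lambda>n. inv J (t n)"]) simp
  qed
  have lim: "(\<lambda>n. ?p (s n)) \<longlonglongrightarrow> g z" if "(\<lambda>n. J (s n)) \<longlonglongrightarrow> z" for s z
    using continuous_on_tendsto_compose[OF cg that] by (simp add: gJ)
  have "bounded_linear g"
  proof (rule bounded_linear_intro)
    fix x y
    obtain s t where st: "(\<lambda>n. J (s n)) \<longlonglongrightarrow> x" "(\<lambda>n. J (t n)) \<longlonglongrightarrow> y"
      using approx[of x] approx[of y] by blast
    have "(\<lambda>n. J (s n + t n)) \<longlonglongrightarrow> x + y"
      using tendsto_add[OF st] by (simp add: linear_add[OF lJ])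
    from lim[OF this] tendsto_add[OF lim[OF st(1)] lim[OF st(2)]]
    show "g (x + y) = g x + g y" by (simp add: linear_add[OF lp] LIMSEQ_unique)
  next
    fix r x
    obtain s where s: "(\<lambda>n. J (s n)) \<longlonglongrightarrow> x" using approx by blast
    have "(\<lambda>n. J (r *\<^sub>R s n)) \<longlonglongrightarrow> r *\<^sub>R x"
      using tendsto_scaleR[OF tendsto_const s] by (simp add: linear_scale[OF lJ])
    from lim[OF this] tendsto_scaleR[OF tendsto_const lim[OF s], of r]
    show "g (r *\<^sub>R x) = r *\<^sub>R g x" by (simp add: linear_scale[OF lp] LIMSEQ_unique)
  next
    fix x
    obtain s where s: "(\<lambda>n. J (s n)) \<longlonglongrightarrow> x" using approx by blast
    have "norm (g x) \<le> ?K * norm x"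
      by (rule LIMSEQ_le[OF tendsto_norm[OF lim[OF s]] tendsto_mult[OF tendsto_const tendsto_norm[OF s]]])
         (use bd in simp)
    then show "norm (g x) \<le> norm x * ?K" by (simp add: mult.commute)
  qed
  note bl = this
  have ng: "norm (g x) \<le> ?K * norm x" for x
  proof -
    obtain s where s: "(\<lambda>n. J (s n)) \<longlonglongrightarrow> x" using approx by blast
    show ?thesis
      by (rule LIMSEQ_le[OF tendsto_norm[OF lim[OF s]] tendsto_mult[OF tendsto_const tendsto_norm[OF s]]])
         (use bd in simp)
  qed
  show ?thesis
    by (rule exI[of _ "Blinfun g"])
       (use gJ ng K0 in \<open>auto simp: bounded_linear_Blinfun_apply[OF bl] intro!: norm_blinfun_bound\<close>)
qed

lemma dual_extension_unique:
  fixes \<Psi> \<Psi>' :: "'z::banach \<Rightarrow>\<^sub>L real"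
  assumes J: "is_completion \<alpha> J" and eq: "\<And>u. blinfun_apply \<Psi> (J u) = blinfun_apply \<Psi>' (J u)"
  shows "\<Psi> = \<Psi>'"
proof (rule blinfun_eqI)
  fix z
  have "z \<in> closure (range J)" using J by (simp add: is_completion_def)
  moreover have "closed {z. blinfun_apply \<Psi> z = blinfun_apply \<Psi>' z}"
    by (intro closed_Collect_eq continuous_intros)
  moreover have "range J \<subseteq> {z. blinfun_apply \<Psi> z = blinfun_apply \<Psi>' z}"
    using eq by auto
  ultimately have "z \<in> {z. blinfun_apply \<Psi> z = blinfun_apply \<Psi>' z}"
    by (meson closure_minimal subsetD)
  then show "blinfun_apply \<Psi> z = blinfun_apply \<Psi>' z" by simp
qed

lemma dual_embed:
  assumes "is_norm \<alpha>" "dual_norm_finite \<alpha>" and J: "is_completion \<alpha> J"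
  shows "blinfun_apply (dual_embed J \<phi>) (J u) = tensor_pairing \<phi> u"
proof -
  have "\<exists>!\<Psi>. \<forall>u. blinfun_apply \<Psi> (J u) = tensor_pairing \<phi> u"
  proof (rule ex_ex1I)
    show "\<exists>\<Psi>. \<forall>u. blinfun_apply \<Psi> (J u) = tensor_pairing \<phi> u"
      using dual_extension_exists[OF assms, of \<phi>] by blast
  qed (rule dual_extension_unique[OF J], simp)
  from theI'[OF this] show ?thesis unfolding dual_embed_def by (rule spec)
qed

lemma norm_dual_embed:
  assumes "is_norm \<alpha>" "dual_norm_finite \<alpha>" and J: "is_completion \<alpha> J"
  shows "norm (dual_embed J \<phi>) = dual_norm \<alpha> \<phi>"
proof (rule antisym)
  obtain \<Psi> where \<Psi>: "\<forall>u. blinfun_apply \<Psi> (J u) = tensor_pairing \<phi> u" "norm \<Psi> \<le> dual_norm \<alpha> \<phi>"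
    using dual_extension_exists[OF assms] by blast
  have "\<Psi> = dual_embed J \<phi>"
    by (rule dual_extension_unique[OF J]) (simp add: \<Psi>(1) dual_embed[OF assms])
  then show "norm (dual_embed J \<phi>) \<le> dual_norm \<alpha> \<phi>" using \<Psi> by simp
next
  have "\<alpha> 0 = 0" using assms(1) by (simp add: is_norm_def)
  then have ne: "{\<bar>tensor_pairing \<phi> u\<bar> | u. \<alpha> u \<le> 1} \<noteq> {}"
    by (metis (mono_tags, lifting) empty_iff mem_Collect_eq zero_le_one)
  show "dual_norm \<alpha> \<phi> \<le> norm (dual_embed J \<phi>)"
    unfolding dual_norm_def
  proof (rule cSup_least[OF ne])
    fix r assume "r \<in> {\<bar>tensor_pairing \<phi> u\<bar> | u. \<alpha> u \<le> 1}"
    then obtain u where u: "r = \<bar>tensor_pairing \<phi> u\<bar>" "\<alpha> u \<le> 1" by blast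
    have "r \<le> norm (dual_embed J \<phi>) * norm (J u)"
      using norm_blinfun[of "dual_embed J \<phi>" "J u"] by (simp add: u dual_embed[OF assms])
    also have "\<dots> \<le> norm (dual_embed J \<phi>) * 1"
      using u J by (intro mult_left_mono) (auto simp: is_completion_def)
    finally show "r \<le> norm (dual_embed J \<phi>)" by simp
  qed
qed

definition dual_ball_odot ::
  "('a::real_normed_vector \<Rightarrow>\<^sub>L real, 'b::real_normed_vector \<Rightarrow>\<^sub>L real) tensor set"
  where "dual_ball_odot =
    {(\<Sum>k=1..n. l k *\<^sub>R (f k \<otimes>\<^sub>t g k)) | (n :: nat) f g l.
       (\<forall>k\<in>{1..n}. f k \<in> cball 0 1 \<and> g k \<in> cball 0 1 \<and> 0 \<le> l k) \<and> (\<Sum>k=1..n. l k) \<le> 1}"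

text \<open>
  Since \<open>dual_embed J\<close> is isometric for the dual norm, the closure of the embedded set is taken in
  the operator norm of the dual of the completion.
\<close>

definition dual_ball_otimes ::
  "(('a::real_normed_vector, 'b::real_normed_vector) tensor \<Rightarrow> 'z::banach) \<Rightarrow> ('z \<Rightarrow>\<^sub>L real) set"
  where "dual_ball_otimes J = closure (dual_embed J ` dual_ball_odot)"


section \<open>Ergodic and uniformly weakly mixing sequences\<close>

text \<open>Sequences are indexed from 1; the value at index 0 is irrelevant.\<close>

definition ergodic :: "(nat \<Rightarrow> 'z::banach) \<Rightarrow> bool"
  where "ergodic z \<longleftrightarrow> (\<lambda>n. 1 / real n * norm (\<Sum>k=1..n. z k)) \<longlonglongrightarrow> 0"

definition uniformly_weakly_mixing_to_zero :: "(nat \<Rightarrow> 'z::banach) \<Rightarrow> bool"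
  where "uniformly_weakly_mixing_to_zero z \<longleftrightarrow>
    (\<lambda>n. SUP f\<in>cball (0 :: 'z \<Rightarrow>\<^sub>L real) 1. 1 / real n * (\<Sum>k=1..n. \<bar>blinfun_apply f (z k)\<bar>))
      \<longlonglongrightarrow> 0"

end

theory Submission
  imports Defs
begin

text \<open>
  Testing against \<open>f \<otimes> f\<close> and the Cauchy-Schwarz inequality bound the weak averages of \<open>x\<close> by the
  square root of the norm averages of \<open>x k \<otimes> x k\<close>. Conversely, the set of functionals on the
  completion whose weak average is at most a given constant is closed, so by the hypothesis on the
  dual ball it is enough to test convex combinations of elementary tensors \<open>f \<otimes> g\<close>, for which
  \<open>\<bar>f (x k) * g (x k)\<bar> \<le> M * \<bar>f (x k)\<bar>\<close>. That uniform weak mixing implies ergodicity is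
  the Hahn-Banach theorem; norming functionals are obtained as minimal sublinear functionals.
\<close>

section \<open>Norming functionals\<close>

text \<open>Homogeneity is demanded only as an inequality for positive factors, which is all that
  has to be checked for tilts and infima. Applying it to \<open>inverse c\<close> as well recovers
  equality in \<open>sublinear_scaleR\<close>.\<close>

definition sublinear :: "('v::real_vector \<Rightarrow> real) \<Rightarrow> bool" where
  "sublinear p \<longleftrightarrow> (\<forall>x y. p (x + y) \<le> p x + p y) \<and> (\<forall>c x. 0 < c \<longrightarrow> p (c *\<^sub>R x) \<le> c * p x)"

lemma sublinear_add: "sublinear p \<Longrightarrow> p (x + y) \<le> p x + p y"
  by (simp add: sublinear_def)

lemma sublinear_zero:
  assumes "sublinear p"
  shows "p 0 = 0"
proof -
  \<comment> \<open>The factor 1/2 forces \<open>p 0\<close> to be at most 0, the factor 2 forces it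
    to be at least 0.\<close>
  have "p ((1/2) *\<^sub>R 0) \<le> (1/2) * p 0" "p (2 *\<^sub>R 0) \<le> 2 * p 0"
    using assms unfolding sublinear_def by (metis half_gt_zero_iff zero_less_one, metis zero_less_numeral)
  then show ?thesis by simp
qed

lemma sublinear_scaleR:
  assumes p: "sublinear p" and "0 \<le> c"
  shows "p (c *\<^sub>R x) = c * p x"
proof (cases "c = 0")
  case True
  then show ?thesis by (simp add: sublinear_zero[OF p])
next
  case False
  with assms(2) have c: "0 < c" by simp
  have "p (inverse c *\<^sub>R (c *\<^sub>R x)) \<le> inverse c * p (c *\<^sub>R x)"
    using p c unfolding sublinear_def by (meson positive_imp_inverse_positive)
  then have "c * p x \<le> p (c *\<^sub>R x)" using c by (simp add: field_simps)
  moreover have "p (c *\<^sub>R x) \<le> c * p x" using p c by (simp add: sublinear_def)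
  ultimately show ?thesis by simp
qed

text \<open>This keeps pointwise infima finite: sublinear functionals below a common
  \<open>p\<close> are all at least \<open>- p (- x)\<close> at \<open>x\<close>.\<close>

lemma sublinear_lower:
  assumes "sublinear p"
  shows "- p (- x) \<le> p x"
  using sublinear_add[OF assms, of x "- x"] sublinear_zero[OF assms] by simp

lemma sublinear_norm: "sublinear (norm :: 'v::real_normed_vector \<Rightarrow> real)"
  by (simp add: sublinear_def norm_triangle_ineq)

text \<open>The largest sublinear functional below \<open>p\<close> whose value at \<open>- y\<close> is at most \<open>- p y\<close>.\<close>

definition tilt :: "('v::real_vector \<Rightarrow> real) \<Rightarrow> 'v \<Rightarrow> 'v \<Rightarrow> real" where
  "tilt p y x = (INF t\<in>{0..}. p (x + t *\<^sub>R y) - t * p y)"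

lemma tilt_le:
  assumes p: "sublinear p" and "0 \<le> t"
  shows "tilt p y x \<le> p (x + t *\<^sub>R y) - t * p y"
  unfolding tilt_def
proof (rule cINF_lower)
  show "bdd_below ((\<lambda>t. p (x + t *\<^sub>R y) - t * p y) ` {0..})"
  proof (rule bdd_belowI2)
    fix s :: real assume "s \<in> {0..}"
    \<comment> \<open>A real infimum is a lower bound only of a family bounded below. Here
      \<open>s *\<^sub>R y\<close> is the sum of \<open>x + s *\<^sub>R y\<close> and
      \<open>- x\<close>, and \<open>p\<close> takes the value \<open>s * p y\<close> on it.\<close>
    then show "- p (- x) \<le> p (x + s *\<^sub>R y) - s * p y"
      using sublinear_add[OF p, of "x + s *\<^sub>R y" "- x"] sublinear_scaleR[OF p, of s y] by simp
  qed
qed (use assms in simp)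

lemma tilt_greatest:
  assumes "\<And>t. 0 \<le> t \<Longrightarrow> c \<le> p (x + t *\<^sub>R y) - t * p y"
  shows "c \<le> tilt p y x"
  unfolding tilt_def using assms by (intro cINF_greatest) auto

lemma tilt_le_self: "sublinear p \<Longrightarrow> tilt p y x \<le> p x"
  using tilt_le[of p 0 y x] by simp

text \<open>For subadditivity, parameters \<open>t\<close> and \<open>s\<close> for the two summands
  combine to \<open>t + s\<close>, and the two infima are taken one after the other. For
  homogeneity, the parameter \<open>t\<close> at \<open>x\<close> corresponds to
  \<open>c * t\<close> at \<open>c *\<^sub>R x\<close>.\<close>

lemma sublinear_tilt:
  assumes p: "sublinear p"
  shows "sublinear (tilt p y)"
  unfolding sublinear_def
proof (intro conjI allI impI)
  fix x x'
  have "tilt p y (x + x') - (p (x' + s *\<^sub>R y) - s * p y) \<le> tilt p y x" if "0 \<le> s" for s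
  proof (rule tilt_greatest)
    fix t :: real assume "0 \<le> t"
    then have "tilt p y (x + x') \<le> p ((x + x') + (t + s) *\<^sub>R y) - (t + s) * p y"
      using that by (intro tilt_le[OF p]) simp
    moreover have "p ((x + x') + (t + s) *\<^sub>R y) \<le> p (x + t *\<^sub>R y) + p (x' + s *\<^sub>R y)"
      using sublinear_add[OF p, of "x + t *\<^sub>R y" "x' + s *\<^sub>R y"] by (simp add: algebra_simps)
    ultimately show "tilt p y (x + x') - (p (x' + s *\<^sub>R y) - s * p y) \<le> p (x + t *\<^sub>R y) - t * p y"
      by (simp add: algebra_simps)
  qed
  then have "tilt p y (x + x') - tilt p y x \<le> tilt p y x'"
    by (intro tilt_greatest) (simp add: algebra_simps)
  then show "tilt p y (x + x') \<le> tilt p y x + tilt p y x'" by simp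
next
  fix c :: real and x assume c: "0 < c"
  have "tilt p y (c *\<^sub>R x) / c \<le> tilt p y x"
  proof (rule tilt_greatest)
    fix t :: real assume "0 \<le> t"
    then have "tilt p y (c *\<^sub>R x) \<le> p (c *\<^sub>R x + (c * t) *\<^sub>R y) - (c * t) * p y"
      using c by (intro tilt_le[OF p]) simp
    also have "p (c *\<^sub>R x + (c * t) *\<^sub>R y) = c * p (x + t *\<^sub>R y)"
      using sublinear_scaleR[OF p, of c "x + t *\<^sub>R y"] c by (simp add: scaleR_add_right)
    finally show "tilt p y (c *\<^sub>R x) / c \<le> p (x + t *\<^sub>R y) - t * p y"
      using c by (simp add: field_simps)
  qed
  then show "tilt p y (c *\<^sub>R x) \<le> c * tilt p y x" using c by (simp add: field_simps)
qed

section \<open>Minimal sublinear functionals by Zorn's lemma, and their linearity\<close>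

lemma sublinear_INF_chain:
  assumes "C \<noteq> {}" and sub: "\<And>q. q \<in> C \<Longrightarrow> sublinear q" and le: "\<And>q x. q \<in> C \<Longrightarrow> q x \<le> p x"
    and chain: "\<And>q r. q \<in> C \<Longrightarrow> r \<in> C \<Longrightarrow> q \<le> r \<or> r \<le> q"
  shows "sublinear (\<lambda>x. INF q\<in>C. q x)" and "q \<in> C \<Longrightarrow> (INF q\<in>C. q x) \<le> q x"
proof -
  have lower: "(INF q\<in>C. q x) \<le> q x" if "q \<in> C" for q x
  proof (rule cINF_lower[OF _ that], rule bdd_belowI2)
    fix r assume "r \<in> C"
    then show "- p (- x) \<le> r x"
      using sublinear_lower[OF sub, of r x] le[of r "- x"] by simp
  qed
  then show "q \<in> C \<Longrightarrow> (INF q\<in>C. q x) \<le> q x" .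
  show "sublinear (\<lambda>x. INF q\<in>C. q x)"
    unfolding sublinear_def
  proof (intro conjI allI impI)
    fix x y
    \<comment> \<open>Infima of sublinear functionals need not be subadditive in general; in a
      chain, the smaller of \<open>q\<close> and \<open>r\<close> serves both arguments at
      once.\<close>
    have *: "(INF q\<in>C. q (x + y)) \<le> q x + r y" if qr: "q \<in> C" "r \<in> C" for q r
    proof -
      obtain s where s: "s \<in> C" "s \<le> q" "s \<le> r"
        using chain[OF qr] qr by blast
      have "(INF q\<in>C. q (x + y)) \<le> s x + s y"
        using lower[OF s(1), of "x + y"] sublinear_add[OF sub[OF s(1)], of x y] by simp
      also have "\<dots> \<le> q x + r y" using s by (intro add_mono) (auto simp: le_fun_def)
      finally show ?thesis .
    qed
    have "(INF q\<in>C. q (x + y)) - r y \<le> (INF q\<in>C. q x)" if "r \<in> C" for r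
      using *[OF _ that] assms(1) by (intro cINF_greatest) (simp_all add: algebra_simps)
    then have "(INF q\<in>C. q (x + y)) - (INF q\<in>C. q x) \<le> (INF q\<in>C. q y)"
      using assms(1) by (intro cINF_greatest) (simp_all add: algebra_simps)
    then show "(INF q\<in>C. q (x + y)) \<le> (INF q\<in>C. q x) + (INF q\<in>C. q y)" by simp
  next
    fix c :: real and x assume c: "0 < c"
    have "(INF q\<in>C. q (c *\<^sub>R x)) / c \<le> (INF q\<in>C. q x)"
    proof (rule cINF_greatest[OF assms(1)])
      fix q assume q: "q \<in> C"
      have "(INF q\<in>C. q (c *\<^sub>R x)) \<le> c * q x"
        using lower[OF q, of "c *\<^sub>R x"] sublinear_scaleR[OF sub[OF q], of c x] c by simp
      then show "(INF q\<in>C. q (c *\<^sub>R x)) / c \<le> q x" using c by (simp add: field_simps)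
    qed
    then show "(INF q\<in>C. q (c *\<^sub>R x)) \<le> c * (INF q\<in>C. q x)" using c by (simp add: field_simps)
  qed
qed

lemma minimal_sublinear_exists:
  assumes p: "sublinear p"
  obtains q where "sublinear q" "q \<le> p" "\<forall>r. sublinear r \<longrightarrow> r \<le> q \<longrightarrow> r = q"
proof -
  let ?A = "{q. sublinear q \<and> q \<le> p}"
  have "\<exists>m\<in>?A. \<forall>a\<in>?A. a \<le> m \<longrightarrow> a = m"
  \<comment> \<open>Zorn's lemma yields maximal elements, so the order is reversed: a chain is
    bounded by its pointwise infimum, and the empty chain by \<open>p\<close> itself.\<close>
  proof (rule predicate_Zorn[where P = "\<lambda>q r. r \<le> q"])
    show "partial_order_on ?A (relation_of (\<lambda>q r. r \<le> q) ?A)"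
      by (rule partial_order_on_relation_ofI) auto
  next
    fix C assume C: "C \<in> Chains (relation_of (\<lambda>q r. r \<le> q) ?A)"
    then have CA: "C \<subseteq> ?A" by (rule Chains_relation_of)
    show "\<exists>u\<in>?A. \<forall>a\<in>C. u \<le> a"
    proof (cases "C = {}")
      case True
      then show ?thesis using p by auto
    next
      case False
      have chain: "q \<le> r \<or> r \<le> q" if "q \<in> C" "r \<in> C" for q r
        using C that unfolding Chains_def relation_of_def by blast
      have sub: "q \<in> C \<Longrightarrow> sublinear q" and le: "q \<in> C \<Longrightarrow> q x \<le> p x" for q x
        using CA by (auto simp: le_fun_def)
      have inf: "sublinear (\<lambda>x. INF q\<in>C. q x)"
        by (rule sublinear_INF_chain(1)[where p = p, OF False]) (rule sub le chain; assumption)+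
      have lower: "(INF q\<in>C. q x) \<le> q x" if "q \<in> C" for q x
        by (rule sublinear_INF_chain(2)[where p = p, OF False _ _ _ that]) (rule sub le chain; assumption)+
      obtain q0 where q0: "q0 \<in> C" using False by blast
      have "(INF q\<in>C. q x) \<le> p x" for x
        using lower[OF q0, of x] le[OF q0, of x] by simp
      then show ?thesis
        using inf lower by (intro bexI[of _ "\<lambda>x. INF q\<in>C. q x"]) (auto simp: le_fun_def)
    qed
  qed
  then obtain m where "sublinear m" "m \<le> p" "\<forall>a\<in>?A. a \<le> m \<longrightarrow> a = m" by blast
  then show ?thesis by (intro that[of m]) (auto intro: order_trans)
qed

text \<open>A minimal \<open>q\<close> below \<open>p\<close> is linear: \<open>tilt q y\<close> is
  sublinear and at most \<open>q\<close>, hence equal to \<open>q\<close>, and the parameter 1 in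
  its infimum gives the converse of subadditivity.\<close>

lemma linear_below_sublinear:
  assumes p: "sublinear p"
  obtains f where "linear f" "f \<le> p"
proof -
  obtain q where q: "sublinear q" "q \<le> p" and min: "\<forall>r. sublinear r \<longrightarrow> r \<le> q \<longrightarrow> r = q"
    by (rule minimal_sublinear_exists[OF p])
  have add: "q (x + y) = q x + q y" for x y
  proof -
    have "tilt q y = q"
      by (intro min[rule_format] sublinear_tilt[OF q(1)] le_funI tilt_le_self[OF q(1)])
    then have "q x \<le> q (x + y) - q y" using tilt_le[OF q(1), of 1 y x] by simp
    with sublinear_add[OF q(1), of x y] show ?thesis by simp
  qed
  have neg: "q (- x) = - q x" for x
    using add[of x "- x"] sublinear_zero[OF q(1)] by simp
  have "q (c *\<^sub>R x) = c * q x" for c x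
  proof (cases "0 \<le> c")
    case False
    then show ?thesis using sublinear_scaleR[OF q(1), of "- c" x] by (simp add: neg)
  qed (rule sublinear_scaleR[OF q(1)])
  then have "linear q" by (intro linearI) (simp_all add: add)
  then show ?thesis using q(2) by (rule that)
qed

text \<open>Starting from \<open>tilt norm z\<close> instead of \<open>norm\<close> forces the value
  at \<open>z\<close>: with parameter 1 the tilt is at most \<open>- norm z\<close> at
  \<open>- z\<close>, so a linear \<open>f\<close> below it has \<open>f z\<close> at least
  \<open>norm z\<close>, while still \<open>f \<le> norm\<close>.\<close>

lemma norming_functional:
  fixes z :: "'v::real_normed_vector"
  obtains f :: "'v \<Rightarrow>\<^sub>L real" where "norm f \<le> 1" "blinfun_apply f z = norm z"
proof -
  obtain f where f: "linear f" "f \<le> tilt norm z"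
    by (rule linear_below_sublinear[OF sublinear_tilt[OF sublinear_norm]])
  have le: "f x \<le> norm x" for x
    using le_funD[OF f(2), of x] tilt_le_self[OF sublinear_norm, of z x] by linarith
  have abs: "\<bar>f x\<bar> \<le> norm x" for x
    using le[of x] le[of "- x"] by (simp add: linear_neg[OF f(1)] abs_le_iff)
  have bl: "bounded_linear f"
    using abs by (intro bounded_linear_intro[where K = 1])
      (simp_all add: linear_add[OF f(1)] linear_scale[OF f(1)])
  have "f (- z) \<le> tilt norm z (- z)" using f(2) by (simp add: le_fun_def)
  also have "\<dots> \<le> - norm z" using tilt_le[OF sublinear_norm, of 1 z "- z"] by simp
  finally have "f z = norm z" using le[of z] by (simp add: linear_neg[OF f(1)])
  then have "blinfun_apply (Blinfun f) z = norm z"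
    by (simp only: bounded_linear_Blinfun_apply[OF bl])
  moreover have "norm (Blinfun f) \<le> 1"
    using abs by (intro norm_blinfun_bound) (simp_all add: bounded_linear_Blinfun_apply[OF bl])
  ultimately show ?thesis by (rule that[rotated])
qed

section \<open>Weak averages\<close>

abbreviation weak_average :: "(nat \<Rightarrow> 'z::real_normed_vector) \<Rightarrow> nat \<Rightarrow> ('z \<Rightarrow>\<^sub>L real) \<Rightarrow> real" where
  "weak_average z n f \<equiv> 1 / real n * (\<Sum>k=1..n. \<bar>blinfun_apply f (z k)\<bar>)"

text \<open>A real supremum bounds only a family that is bounded above; the average of the norms
  supplies such a bound.\<close>

lemma weak_average_le_SUP:
  assumes "norm f \<le> 1"
  shows "weak_average z n f \<le> (SUP f\<in>cball 0 1. weak_average z n f)"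
proof (rule cSUP_upper)
  show "bdd_above (weak_average z n ` cball 0 1)"
  proof (rule bdd_aboveI2)
    fix g :: "'a \<Rightarrow>\<^sub>L real" assume "g \<in> cball 0 1"
    then have "\<bar>blinfun_apply g y\<bar> \<le> norm y" for y
      using norm_blinfun[of g y] mult_right_mono[of "norm g" 1 "norm y"] by simp
    then show "weak_average z n g \<le> 1 / real n * (\<Sum>k=1..n. norm (z k))"
      by (intro mult_left_mono sum_mono) auto
  qed
qed (use assms in simp)

lemma SUP_weak_average_le:
  assumes "\<And>f. norm f \<le> 1 \<Longrightarrow> weak_average z n f \<le> c"
  shows "(SUP f\<in>cball 0 1. weak_average z n f) \<le> c"
  using assms by (intro cSUP_least) auto

lemma SUP_weak_average_nonneg: "0 \<le> (SUP f\<in>cball 0 1. weak_average z n f)"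
  using weak_average_le_SUP[where f = 0 and z = z and n = n] by simp

lemma uniformly_weakly_mixing_boundI:
  assumes "c \<longlonglongrightarrow> 0" and "\<And>n f. norm f \<le> 1 \<Longrightarrow> weak_average z n f \<le> c n"
  shows "uniformly_weakly_mixing_to_zero z"
  unfolding uniformly_weakly_mixing_to_zero_def
  by (rule tendsto_sandwich[OF always_eventually always_eventually tendsto_const assms(1)])
    (intro allI SUP_weak_average_nonneg, intro allI SUP_weak_average_le assms(2))

lemma uniformly_weakly_mixing_imp_ergodic:
  assumes "uniformly_weakly_mixing_to_zero z"
  shows "ergodic z"
  unfolding ergodic_def
proof (rule tendsto_sandwich[OF _ _ tendsto_const assms[unfolded uniformly_weakly_mixing_to_zero_def]])
  show "\<forall>\<^sub>F n in sequentially. 1 / real n * norm (\<Sum>k=1..n. z k)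
      \<le> (SUP f\<in>cball 0 1. weak_average z n f)"
  proof (rule always_eventually, rule allI)
    fix n
    \<comment> \<open>The functional norming the partial sum changes with \<open>n\<close>, so the
      bound uniform in \<open>f\<close> is used.\<close>
    obtain f where f: "norm f \<le> 1" "blinfun_apply f (\<Sum>k=1..n. z k) = norm (\<Sum>k=1..n. z k)"
      by (rule norming_functional)
    have "norm (\<Sum>k=1..n. z k) \<le> (\<Sum>k=1..n. \<bar>blinfun_apply f (z k)\<bar>)"
      unfolding f(2)[symmetric] blinfun.sum_right
      by (rule order_trans[OF abs_ge_self sum_abs])
    then have "1 / real n * norm (\<Sum>k=1..n. z k) \<le> weak_average z n f"
      by (intro mult_left_mono) auto
    also have "\<dots> \<le> (SUP f\<in>cball 0 1. weak_average z n f)" by (rule weak_average_le_SUP[OF f(1)])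
    finally show "1 / real n * norm (\<Sum>k=1..n. z k) \<le> \<dots>" .
  qed
qed simp

section \<open>Passing between a sequence and its tensor squares\<close>

lemma weak_average_squared_le:
  fixes f :: "'v::real_normed_vector \<Rightarrow>\<^sub>L real"
  shows "(weak_average x n f)\<^sup>2 \<le> 1 / real n * (\<Sum>k=1..n. (blinfun_apply f (x k))\<^sup>2)"
proof (cases "n = 0")
  case False
  have "(\<Sum>k=1..n. \<bar>blinfun_apply f (x k)\<bar>)\<^sup>2 \<le> (\<Sum>k=1..n. \<bar>blinfun_apply f (x k)\<bar>\<^sup>2) * card {1..n}"
    by (rule sum_squared_le_sum_of_squares)
  then show ?thesis using False by (simp add: field_simps power2_eq_square)
qed simp

lemma ergodic_imp_uniformly_weakly_mixing:
  fixes \<alpha> :: "('a::banach, 'a) tensor \<Rightarrow> real" and J :: "('a, 'a) tensor \<Rightarrow> 'z::banach"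
  assumes "is_norm \<alpha>" "dual_norm_finite \<alpha>" and cross: "cross_norm (dual_norm \<alpha>)"
    and J: "is_completion \<alpha> J" and erg: "ergodic (\<lambda>k. J (x k \<otimes>\<^sub>t x k))"
  shows "uniformly_weakly_mixing_to_zero x"
proof -
  let ?e = "\<lambda>n. 1 / real n * norm (\<Sum>k=1..n. J (x k \<otimes>\<^sub>t x k))"
  have bound: "weak_average x n f \<le> sqrt (?e n)" if f: "norm f \<le> 1" for n f
  proof (rule real_le_rsqrt)
    let ?\<Psi> = "dual_embed J (f \<otimes>\<^sub>t f)"
    \<comment> \<open>The cross property of the dual norm enters here, through the isometry
      \<open>dual_embed J\<close>.\<close>
    have "norm ?\<Psi> = norm f * norm f"
      using norm_dual_embed[OF assms(1,2) J] cross by (simp add: cross_norm_def)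
    then have \<Psi>: "norm ?\<Psi> \<le> 1" using f by (simp add: mult_le_one)
    have "(\<Sum>k=1..n. (blinfun_apply f (x k))\<^sup>2) = blinfun_apply ?\<Psi> (\<Sum>k=1..n. J (x k \<otimes>\<^sub>t x k))"
      by (simp add: blinfun.sum_right dual_embed[OF assms(1,2) J] tensor_pairing_elementary
          power2_eq_square)
    also have "\<dots> \<le> norm ?\<Psi> * norm (\<Sum>k=1..n. J (x k \<otimes>\<^sub>t x k))"
      by (rule order_trans[OF abs_ge_self]) (rule norm_blinfun[of ?\<Psi>, unfolded real_norm_def])
    also have "\<dots> \<le> norm (\<Sum>k=1..n. J (x k \<otimes>\<^sub>t x k))"
      using \<Psi> by (intro mult_left_le_one_le) auto
    finally have "1 / real n * (\<Sum>k=1..n. (blinfun_apply f (x k))\<^sup>2) \<le> ?e n"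
      by (intro mult_left_mono) auto
    with weak_average_squared_le show "(weak_average x n f)\<^sup>2 \<le> ?e n" by (rule order_trans)
  qed
  have "(\<lambda>n. sqrt (?e n)) \<longlonglongrightarrow> 0"
    using tendsto_real_sqrt[OF erg[unfolded ergodic_def]] by simp
  then show ?thesis
    using bound by (rule uniformly_weakly_mixing_boundI)
qed

text \<open>In each elementary term the factor from \<open>g i\<close> is absorbed into
  \<open>M\<close> and the one from \<open>f i\<close> is kept, which leaves weak averages of
  \<open>x\<close> with nonnegative weights of total at most 1.\<close>

lemma dual_ball_odot_weak_average_le:
  fixes \<alpha> :: "('a::banach, 'a) tensor \<Rightarrow> real" and J :: "('a, 'a) tensor \<Rightarrow> 'z::banach"
  assumes "is_norm \<alpha>" "dual_norm_finite \<alpha>" and J: "is_completion \<alpha> J"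
    and M: "\<And>k. 1 \<le> k \<Longrightarrow> norm (x k) \<le> M" "0 \<le> M" and \<phi>: "\<phi> \<in> dual_ball_odot"
  shows "weak_average (\<lambda>k. J (x k \<otimes>\<^sub>t x k)) n (dual_embed J \<phi>)
    \<le> M * (SUP f\<in>cball 0 1. weak_average x n f)" (is "_ \<le> M * ?s")
proof -
  obtain m :: nat and f g l where eq: "\<phi> = (\<Sum>i=1..m. l i *\<^sub>R (f i \<otimes>\<^sub>t g i))"
    and fgl: "\<And>i. i \<in> {1..m} \<Longrightarrow> norm (f i) \<le> 1 \<and> norm (g i) \<le> 1 \<and> 0 \<le> l i"
    and l: "(\<Sum>i=1..m. l i) \<le> 1"
    using \<phi> unfolding dual_ball_odot_def by auto
  have lin: "linear (\<lambda>\<phi>. tensor_pairing \<phi> u)" for u :: "('a, 'a) tensor"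
    using bilinear_tensor_pairing by (auto simp: bilinear_def)
  have term_le: "\<bar>blinfun_apply (dual_embed J \<phi>) (J (x k \<otimes>\<^sub>t x k))\<bar>
      \<le> (\<Sum>i=1..m. l i * M * \<bar>blinfun_apply (f i) (x k)\<bar>)" if k: "k \<in> {1..n}" for k
  proof -
    have "\<bar>l i * (blinfun_apply (f i) (x k) * blinfun_apply (g i) (x k))\<bar>
        \<le> l i * M * \<bar>blinfun_apply (f i) (x k)\<bar>" if i: "i \<in> {1..m}" for i
    proof -
      have "\<bar>blinfun_apply (g i) (x k)\<bar> \<le> norm (g i) * norm (x k)"
        using norm_blinfun[of "g i" "x k"] by simp
      also have "\<dots> \<le> 1 * M" using fgl[OF i] M k by (intro mult_mono) auto
      finally have "\<bar>blinfun_apply (f i) (x k)\<bar> * \<bar>blinfun_apply (g i) (x k)\<bar>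
          \<le> \<bar>blinfun_apply (f i) (x k)\<bar> * M"
        by (intro mult_left_mono) auto
      from mult_left_mono[OF this, of "l i"] show ?thesis
        using fgl[OF i] by (simp add: abs_mult mult_ac)
    qed
    then have "\<bar>\<Sum>i=1..m. l i * (blinfun_apply (f i) (x k) * blinfun_apply (g i) (x k))\<bar>
        \<le> (\<Sum>i=1..m. l i * M * \<bar>blinfun_apply (f i) (x k)\<bar>)"
      by (intro order_trans[OF sum_abs sum_mono])
    then show ?thesis
      by (simp add: dual_embed[OF assms(1,2) J] eq linear_sum[OF lin] linear_scale[OF lin]
          tensor_pairing_elementary)
  qed
  have "weak_average (\<lambda>k. J (x k \<otimes>\<^sub>t x k)) n (dual_embed J \<phi>)
      \<le> 1 / real n * (\<Sum>k=1..n. \<Sum>i=1..m. l i * M * \<bar>blinfun_apply (f i) (x k)\<bar>)"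
    by (intro mult_left_mono sum_mono term_le) auto
  also have "\<dots> = M * (\<Sum>i=1..m. l i * weak_average x n (f i))"
    by (subst sum.swap) (simp add: sum_distrib_left mult_ac)
  also have "\<dots> \<le> M * (\<Sum>i=1..m. l i * ?s)"
    using fgl by (intro mult_left_mono sum_mono weak_average_le_SUP M(2)) auto
  \<comment> \<open>Replacing the total weight by 1 relies on \<open>?s\<close> being
    nonnegative.\<close>
  also have "\<dots> \<le> M * (1 * ?s)"
    unfolding sum_distrib_right[symmetric]
    by (intro mult_left_mono mult_right_mono l SUP_weak_average_nonneg M(2))
  finally show ?thesis by simp
qed

lemma uniformly_weakly_mixing_tensor_square:
  fixes \<alpha> :: "('a::banach, 'a) tensor \<Rightarrow> real" and J :: "('a, 'a) tensor \<Rightarrow> 'z::banach"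
  assumes "is_norm \<alpha>" "dual_norm_finite \<alpha>" and J: "is_completion \<alpha> J"
    and ball: "dual_ball_otimes J = cball 0 1" and bnd: "bounded (x ` {1..})"
    and mix: "uniformly_weakly_mixing_to_zero x"
  shows "uniformly_weakly_mixing_to_zero (\<lambda>k. J (x k \<otimes>\<^sub>t x k))"
proof -
  obtain M where M: "0 < M" "\<And>k. 1 \<le> k \<Longrightarrow> norm (x k) \<le> M"
    using bnd unfolding bounded_pos by auto
  let ?z = "\<lambda>k. J (x k \<otimes>\<^sub>t x k)" and ?s = "\<lambda>n. SUP f\<in>cball 0 1. weak_average x n f"
  have bound: "weak_average ?z n \<Psi> \<le> M * ?s n" if "norm \<Psi> \<le> 1" for n \<Psi>
  proof -
    \<comment> \<open>For fixed \<open>n\<close> the weak average is continuous in \<Psi>, so the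
      bound passes to the closure, which by hypothesis is the whole unit ball.\<close>
    have "closed {\<Psi>. weak_average ?z n \<Psi> \<le> M * ?s n}"
      by (intro closed_Collect_le continuous_intros)
    moreover have "dual_embed J ` dual_ball_odot \<subseteq> {\<Psi>. weak_average ?z n \<Psi> \<le> M * ?s n}"
      using dual_ball_odot_weak_average_le[OF assms(1,2) J M(2)] M(1) by auto
    ultimately have "closure (dual_embed J ` dual_ball_odot) \<subseteq> {\<Psi>. weak_average ?z n \<Psi> \<le> M * ?s n}"
      by (rule closure_minimal[rotated])
    moreover have "\<Psi> \<in> closure (dual_embed J ` dual_ball_odot)"
      using ball that unfolding dual_ball_otimes_def by simp
    ultimately show ?thesis by blast
  qed
  have "(\<lambda>n. M * ?s n) \<longlonglongrightarrow> 0"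
    using mix unfolding uniformly_weakly_mixing_to_zero_def by (rule tendsto_mult_right_zero)
  then show ?thesis
    using bound by (rule uniformly_weakly_mixing_boundI)
qed

theorem theorem2p7:
  fixes \<alpha> :: "('a::banach, 'a) tensor \<Rightarrow> real"
    and J :: "('a, 'a) tensor \<Rightarrow> 'z::banach"
    and x :: "nat \<Rightarrow> 'a"
  assumes "cross_norm \<alpha>"
    and "dual_norm_finite \<alpha>"
    and "cross_norm (dual_norm \<alpha>)"
    and "is_completion \<alpha> J"
    and "dual_ball_otimes J = cball 0 1"
    and "bounded (x ` {1..})"
  shows "(ergodic (\<lambda>k. J (x k \<otimes>\<^sub>t x k)) \<longleftrightarrow>
            uniformly_weakly_mixing_to_zero (\<lambda>k. J (x k \<otimes>\<^sub>t x k))) \<and>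
         (uniformly_weakly_mixing_to_zero (\<lambda>k. J (x k \<otimes>\<^sub>t x k)) \<longleftrightarrow>
            uniformly_weakly_mixing_to_zero x)"
proof -
  have "is_norm \<alpha>" using assms(1) by (simp add: cross_norm_def)
  \<comment> \<open>The implications form a cycle: ergodic squares, mixing of \<open>x\<close>,
    mixing of the squares, ergodic squares.\<close>
  note ergodic_imp_uniformly_weakly_mixing[OF this assms(2-4), of x]
    and uniformly_weakly_mixing_tensor_square[OF this assms(2,4-6)]
    and uniformly_weakly_mixing_imp_ergodic[of "\<lambda>k. J (x k \<otimes>\<^sub>t x k)"]
  then show ?thesis by argo
qed

end
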